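(* Let $A\in\mathbb{R}^{n\times n}$ and $B\in\mathbb{R}^{n\times s}$ be constant matrices. Let $X(t)$ be the exact solution on $[t_0,T_f]$ of $\dot X(t)=AX(t)+X(t)A^T+BB^T$, $X(t_0)=X_0$, and let $X_m(t)=\mathcal{V}_mG_m(t)\mathcal{V}_m^T$ be the approximate solution obtained at step $m$ of the block Arnoldi ($d=s$) or extended block Arnoldi ($d=2s$) method, as described in the context. Assume that $A$ is a stable matrix and that $X(t_0)=X_m(t_0)$. Then the error $E_m(t)=X(t)-X_m(t)$ satisfies, for $t\in[t_0,T_f]$, $$\|E_m(t)\|\le\|T_{m+1,m}\|\,\|\bar G_m\|_\infty\,\frac{e^{2(t-t_0)\mu_2(A)}-1}{2\mu_2(A)},$$ where $\mu_2(A)=\frac12\lambda_{\max}(A+A^T)<0$ is the 2-logarithmic norm of $A$, $\|\bar G_m\|_\infty=\max_{\tau\in[t_0,t]}\|\bar G_m(\tau)\|$, and $\bar G_m(\tau)$ is the $d\times md$ matrix formed by the last $d$ rows of $G_m(\tau)$. Here $\|\cdot\|$ is the spectral (matrix 2-) norm.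
   Context: $A$ is nonsingular and $B$ has full rank, with $s\ll n$. A matrix is stable if all its eigenvalues have negative real part; $\lambda_{\max}$ denotes the largest eigenvalue of a symmetric matrix. The block Krylov subspace is $\mathbb{K}_m(A,B)=\mathrm{range}(B,AB,\dots,A^{m-1}B)$; the extended block Krylov subspace is $\mathcal{K}_m(A,B)=\mathrm{range}(A^{-m}B,\dots,A^{-1}B,B,AB,\dots,A^{m-1}B)$. The block Arnoldi algorithm ($d=s$), respectively the extended block Arnoldi algorithm ($d=2s$), applied to the pair $(A,B)$ produces blocks $V_1,\dots,V_{m+1}\in\mathbb{R}^{n\times d}$ such that $\mathcal{V}_{m+1}=[V_1,\dots,V_{m+1}]$ has orthonormal columns, the columns of $\mathcal{V}_m=[V_1,\dots,V_m]$ form an orthonormal basis of $\mathbb{K}_m(A,B)$, respectively $\mathcal{K}_m(A,B)$ (so the columns of $B$ lie in the range of $\mathcal{V}_m$), and $$A\mathcal{V}_m=\mathcal{V}_m\mathcal{T}_m+V_{m+1}T_{m+1,m}E_m^T,$$ where $\mathcal{T}_m=\mathcal{V}_m^TA\mathcal{V}_m\in\mathbb{R}^{md\times md}$ is block upper Hessenberg, $T_{m+1,m}=V_{m+1}^TAV_m\in\mathbb{R}^{d\times d}$, and $E_m=[0_{d\times(m-1)d},I_d]^T$ consists of the last $d$ columns of $I_{md}$. With $B_m=\mathcal{V}_m^TB$, $$G_m(t)=\int_{t_0}^t e^{(t-\tau)\mathcal{T}_m}B_mB_m^Te^{(t-\tau)\mathcal{T}_m^T}\,d\tau .$$ (In particular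 $X_m(t_0)=0$.)
   Formalization: The claim μ₂(A)<0 does not follow from stability (A=[[-1,10],[0,-1]] is stable with μ₂(A)=4), so it is not asserted; the bound is stated for stable A with μ₂(A)≠0, as its right-hand side is undefined when μ₂(A)=0. *)

theory Defs
  imports "HOL-Analysis.Analysis"
begin

section \<open>Spectra, the matrix 2-norm and the 2-logarithmic norm\<close>

definition eigenvalues :: "'a::field^'n^'n \<Rightarrow> 'a set" where
  "eigenvalues M = {c. \<exists>v. v \<noteq> 0 \<and> M *v v = c *s v}"

text \<open>Eigenvalues of a real matrix are taken over the complex numbers here.\<close>

definition stable :: "real^'n^'n \<Rightarrow> bool" where
  "stable A \<longleftrightarrow> (\<forall>c \<in> eigenvalues (map_matrix complex_of_real A). Re c < 0)"

text \<open>Meant for symmetric arguments, whose real eigenvalues form a finite nonempty set.\<close>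

definition lambda_max :: "real^'n^'n \<Rightarrow> real" where
  "lambda_max S = Max (eigenvalues S)"

definition mu2 :: "real^'n^'n \<Rightarrow> real" where
  "mu2 A = lambda_max (A + transpose A) / 2"

text \<open>The library's \<^const>\<open>norm\<close> on matrices is the Frobenius norm; the spectral norm is the
  operator norm induced by the Euclidean vector norms.\<close>

definition spectral_norm :: "real^'n^'m \<Rightarrow> real" where
  "spectral_norm M = onorm (\<lambda>x. M *v x)"


section \<open>Matrix powers and the matrix exponential\<close>

text \<open>The library's power and \<^const>\<open>exp\<close> are not available for the product \<open>**\<close>.\<close>

primrec matpow :: "real^'n^'n \<Rightarrow> nat \<Rightarrow> real^'n^'n" where
  "matpow M 0 = mat 1"
| "matpow M (Suc k) = M ** matpow M k"

definition mexp :: "real^'n^'n \<Rightarrow> real^'n^'n" where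
  "mexp M = (\<Sum>k. (1 / fact k) *\<^sub>R matpow M k)"


section \<open>Block Krylov subspaces\<close>

definition block_krylov :: "real^'n^'n \<Rightarrow> real^'s^'n \<Rightarrow> nat \<Rightarrow> (real^'n) set" where
  "block_krylov A B m = span (\<Union>k<m. columns (matpow A k ** B))"

definition ext_block_krylov :: "real^'n^'n \<Rightarrow> real^'s^'n \<Rightarrow> nat \<Rightarrow> (real^'n) set" where
  "ext_block_krylov A B m =
     span ((\<Union>k\<in>{1..m}. columns (matpow (matrix_inv A) k ** B)) \<union>
           (\<Union>k<m. columns (matpow A k ** B)))"


section \<open>Block-structured matrices\<close>

text \<open>
  A matrix dimension \<open>m d\<close> is represented by the index type \<open>'m \<times> 'd\<close> with \<open>CARD('m) = m\<close> and
  \<open>CARD('d) = d\<close>: the index \<open>(i, c)\<close> is position \<open>c\<close> inside block \<open>i\<close>. The finite linear order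
  on \<open>'m\<close> orders the blocks, and \<open>block_no\<close> numbers them \<open>1, \<dots>, m\<close>.
\<close>

definition block_no :: "'m::{finite,linorder} \<Rightarrow> nat" where
  "block_no i = card {j. j \<le> i}"

definition last_block :: "'m::{finite,linorder}" where
  "last_block = Max UNIV"

lemma block_no_strict_mono: "strict_mono (block_no :: 'm::{finite,linorder} \<Rightarrow> nat)"
proof (rule strict_monoI)
  fix i j :: 'm
  assume "i < j"
  then have "{k. k \<le> i} \<subset> {k. k \<le> j}"
    by (intro psubsetI) (auto dest: leD)
  then show "block_no i < block_no j" by (simp add: block_no_def psubset_card_mono)
qed

lemma bij_betw_block_no:
  "bij_betw (block_no :: 'm::{finite,linorder} \<Rightarrow> nat) UNIV {1..CARD('m)}"
proof -
  have inj: "inj (block_no :: 'm \<Rightarrow> nat)"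
    using block_no_strict_mono by (rule strict_mono_imp_inj_on)
  have "block_no i \<in> {1..CARD('m)}" for i :: 'm
  proof -
    have "0 < card {j. j \<le> i}" by (auto simp: card_gt_0_iff)
    moreover have "card {j. j \<le> i} \<le> CARD('m)" by (rule card_mono) auto
    ultimately show ?thesis by (simp add: block_no_def)
  qed
  then have "range (block_no :: 'm \<Rightarrow> nat) \<subseteq> {1..CARD('m)}" by blast
  moreover have "card (range (block_no :: 'm \<Rightarrow> nat)) = card {1..CARD('m)}"
    by (simp add: card_image[OF inj])
  ultimately have "range (block_no :: 'm \<Rightarrow> nat) = {1..CARD('m)}"
    by (intro card_subset_eq) auto
  with inj show ?thesis by (simp add: bij_betw_def)
qed

lemma block_no_last_block: "block_no (last_block :: 'm::{finite,linorder}) = CARD('m)"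
proof -
  have "{j. j \<le> (last_block :: 'm)} = UNIV" by (auto simp: last_block_def)
  then show ?thesis by (simp add: block_no_def)
qed

text \<open>\<open>[V\<^sub>1, \<dots>, V\<^sub>m]\<close>.\<close>

definition block_row :: "(nat \<Rightarrow> real^'d^'n) \<Rightarrow> real^('m::{finite,linorder} \<times> 'd)^'n" where
  "block_row V = (\<chi> r p. V (block_no (fst p)) $ r $ snd p)"

text \<open>The columns of \<open>[V\<^sub>1, \<dots>, V\<^sub>k]\<close> are orthonormal.\<close>

definition orthonormal_blocks :: "(nat \<Rightarrow> real^'d^'n) \<Rightarrow> nat \<Rightarrow> bool" where
  "orthonormal_blocks V k \<longleftrightarrow>
     (\<forall>i\<in>{1..k}. \<forall>j\<in>{1..k}. \<forall>c e.
        column c (V i) \<bullet> column e (V j) = (if i = j \<and> c = e then 1 else 0))"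

definition block_upper_hessenberg ::
    "real^('m::{finite,linorder} \<times> 'd::finite)^('m \<times> 'd) \<Rightarrow> bool" where
  "block_upper_hessenberg H \<longleftrightarrow>
     (\<forall>i j c e. block_no i > block_no j + 1 \<longrightarrow> H $ (i, c) $ (j, e) = 0)"

text \<open>The last \<open>d\<close> columns of the identity matrix of order \<open>m d\<close>.\<close>

definition last_block_unit :: "real^'d^('m::{finite,linorder} \<times> 'd)" where
  "last_block_unit = (\<chi> p c. mat 1 $ p $ (last_block, c))"

definition last_block_rows :: "real^'k^('m::{finite,linorder} \<times> 'd) \<Rightarrow> real^'k^'d" where
  "last_block_rows M = (\<chi> c. M $ (last_block, c))"

end

theory Submission
  imports Defs
begin

text \<open>
  By the Arnoldi relation the error solves \<open>E' = A E + E A\<^sup>T + R\<close>, \<open>E t0 = 0\<close>, where the residual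
  \<open>R = U N W\<^sup>T + W N\<^sup>T U\<^sup>T\<close> (with \<open>U\<close> the block number \<open>m + 1\<close>, \<open>W\<close> the first \<open>m\<close> blocks, and \<open>N\<close> the
  product of \<open>T\<^bsub>m+1,m\<^esub>\<close> with the last \<open>d\<close> rows of \<open>G\<close>) has spectral norm at most that of \<open>N\<close>,
  because \<open>U\<close> and \<open>W\<close> have mutually orthogonal orthonormal columns. Since the Rayleigh quotients of
  \<open>A + A\<^sup>T\<close> are at most \<open>2 \<mu>\<^sub>2(A)\<close>, the exponential of \<open>u A\<^sup>T\<close> scales norms by at most \<open>exp (u \<mu>\<^sub>2(A))\<close>;
  integrating the residual against two such factors yields the bound.
\<close>

subsection \<open>Matrix algebra\<close>

lemma bounded_bilinear_matrix_mult: "bounded_bilinear ((**) :: real^'k^'n \<Rightarrow> real^'p^'k \<Rightarrow> real^'p^'n)"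
  unfolding bilinear_conv_bounded_bilinear[symmetric] bilinear_def linear_iff
  by (auto simp: matrix_matrix_mult_def vec_eq_iff sum.distrib algebra_simps sum_distrib_left)

lemma bounded_bilinear_matrix_vector_mult: "bounded_bilinear ((*v) :: real^'k^'n \<Rightarrow> real^'k \<Rightarrow> real^'n)"
  unfolding bilinear_conv_bounded_bilinear[symmetric] bilinear_def linear_iff
  by (auto simp: matrix_vector_mult_def vec_eq_iff sum.distrib algebra_simps sum_distrib_left)

lemma bounded_linear_transpose: "bounded_linear (transpose :: real^'k^'n \<Rightarrow> real^'n^'k)"
  unfolding linear_conv_bounded_linear[symmetric] linear_iff
  by (auto simp: transpose_def vec_eq_iff)

lemmas matrix_mult_has_vector_derivative =
  bounded_bilinear.has_vector_derivative[OF bounded_bilinear_matrix_mult]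
lemmas matrix_vector_mult_has_vector_derivative =
  bounded_bilinear.has_vector_derivative[OF bounded_bilinear_matrix_vector_mult]

lemma transpose_add: "transpose (M + N) = transpose M + transpose (N :: real^'k^'n)"
  by (simp add: transpose_def vec_eq_iff)

lemma inner_transpose_mult:
  fixes M :: "real^'k^'n"
  shows "x \<bullet> (transpose M *v y) = (M *v x) \<bullet> y"
  by (metis dot_lmul_matrix transpose_matrix_vector transpose_transpose inner_commute)

subsection \<open>The spectral norm\<close>

lemma norm_mult_le_spectral_norm: "norm (M *v x) \<le> spectral_norm M * norm x"
  unfolding spectral_norm_def by (intro onorm matrix_vector_mul_bounded_linear)

lemma spectral_norm_nonneg: "0 \<le> spectral_norm M"
  unfolding spectral_norm_def by (intro onorm_pos_le matrix_vector_mul_bounded_linear)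

lemma spectral_norm_mult: "spectral_norm (M ** N) \<le> spectral_norm M * spectral_norm N"
proof -
  have "onorm ((*v) M \<circ> (*v) N) \<le> onorm ((*v) M) * onorm ((*v) N)"
    by (intro onorm_compose matrix_vector_mul_bounded_linear)
  then show ?thesis
    by (simp add: spectral_norm_def matrix_vector_mul_assoc o_def)
qed

text \<open>Testing with \<open>x = M *v y\<close> bounds the square of \<open>norm (M *v y)\<close>
  by \<open>b * norm (M *v y) * norm y\<close>, and one factor cancels.\<close>

lemma spectral_norm_leI:
  assumes "\<And>x y. x \<bullet> (M *v y) \<le> b * (norm x * norm y)"
  shows "spectral_norm (M :: real^'k^'n) \<le> b"
  unfolding spectral_norm_def
proof (rule onorm_le)
  fix y
  have "norm (M *v y) * norm (M *v y) \<le> norm (M *v y) * (b * norm y)"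
    using assms[of "M *v y" y] by (simp add: dot_square_norm power2_eq_square algebra_simps)
  \<comment> \<open>With \<open>M *v y = 0\<close> there is no factor to cancel; a unit vector in
    place of \<open>x\<close> supplies the sign instead.\<close>
  moreover have "0 \<le> b * norm y"
    if "M *v y = 0"
    using assms[of "axis undefined 1" y] that by simp
  ultimately show "norm (M *v y) \<le> b * norm y"
    by (cases "M *v y = 0") auto
qed

text \<open>The library norm is bounded on the compact set and dominates the spectral norm up to a
  constant \<open>K\<close>. This makes the supremum in the error bound a genuine upper
  bound.\<close>

lemma bdd_above_spectral_norm:
  fixes M :: "'c::topological_space \<Rightarrow> real^'b^'a"
  assumes "continuous_on S M" "compact S"
  shows "bdd_above ((\<lambda>t. spectral_norm (M t)) ` S)"
proof -
  obtain K where K: "\<And>M x. norm (M *v x :: real^'a) \<le> norm M * norm (x :: real^'b) * K" "K \<ge> 0"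
    using bounded_bilinear.nonneg_bounded[OF bounded_bilinear_matrix_vector_mult] by metis
  obtain b where b: "\<And>t. t \<in> S \<Longrightarrow> norm (M t) \<le> b"
    using compact_imp_bounded[OF compact_continuous_image[OF assms]] 
    by (auto simp: bounded_iff)
  have "spectral_norm (M t) \<le> b * K" if "t \<in> S" for t
    unfolding spectral_norm_def
  proof (rule onorm_le)
    fix x :: "real^'b"
    have "norm (M t) * norm x * K \<le> b * norm x * K"
      using b[OF that] K(2) by (intro mult_right_mono) auto
    then show "norm (M t *v x) \<le> b * K * norm x" 
      using K(1)[of "M t" x] by (simp add: mult_ac)
  qed
  then show ?thesis by (auto intro!: bdd_aboveI)
qed

subsection \<open>The matrix exponential\<close>

lemma matpow_commute: "matpow M k ** M = M ** matpow M k"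
  by (induction k) (simp_all flip: matrix_mul_assoc)

lemma transpose_matpow: "matpow (transpose M) k = transpose (matpow M k)"
proof (induction k)
  case (Suc k)
  have "matpow (transpose M) (Suc k) = transpose (matpow M k ** M)"
    by (simp add: Suc matrix_transpose_mul)
  then show ?case by (simp add: matpow_commute)
qed simp

lemma matpow_scaleR: "matpow (c *\<^sub>R M) k = c ^ k *\<^sub>R matpow (M :: real^'n^'n) k"
  by (induction k) (simp_all add: bounded_bilinear.scaleR_left[OF bounded_bilinear_matrix_mult]
     bounded_bilinear.scaleR_right[OF bounded_bilinear_matrix_mult])

text \<open>Bilinearity bounds a product of matrices by the product of their norms times
  \<open>K\<close>, so \<open>matpow M k\<close> grows at most like \<open>(norm M * K) ^ k\<close>
  and the scalar exponential series dominates.\<close>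

lemma summable_mexp: "summable (\<lambda>k. (1 / fact k) *\<^sub>R matpow M k)"
proof -
  obtain K where K: "\<And>M N. norm (M ** N :: real^'a^'a) \<le> norm M * norm (N :: real^'a^'a) * K" "K \<ge> 0"
    using bounded_bilinear.nonneg_bounded[OF bounded_bilinear_matrix_mult] by metis
  have pow: "norm (matpow M k) \<le> (norm M * K) ^ k * norm (mat 1 :: real^'a^'a)" for k
  proof (induction k)
    case (Suc k)
    have "norm (matpow M (Suc k)) \<le> norm M * norm (matpow M k) * K"
      using K(1) by simp
    also have "\<dots> \<le> norm M * ((norm M * K) ^ k * norm (mat 1 :: real^'a^'a)) * K"
      using Suc K(2) by (intro mult_right_mono mult_left_mono) auto
    finally show ?case by (simp add: mult_ac)
  qed simp
  have "summable (\<lambda>k. (inverse (fact k) * (norm M * K) ^ k) * norm (mat 1 :: real^'a^'a))"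
    by (intro summable_mult2 summable_exp)
  then show ?thesis
  proof (rule summable_comparison_test'[where N = 0])
    fix k
    show "norm ((1 / fact k) *\<^sub>R matpow M k)
        \<le> inverse (fact k) * (norm M * K) ^ k * norm (mat 1 :: real^'a^'a)"
      using mult_left_mono[OF pow[of k], of "inverse (fact k)"]
      by (simp add: inverse_eq_divide)
  qed
qed

lemma mexp_commute: "mexp M ** M = M ** mexp M"
proof -
  interpret mm: bounded_bilinear "(**) :: real^'a^'a \<Rightarrow> real^'a^'a \<Rightarrow> real^'a^'a"
    by (rule bounded_bilinear_matrix_mult)
  have "mexp M ** M = (\<Sum>k. (1 / fact k) *\<^sub>R (matpow M k ** M))"
    unfolding mexp_def bounded_linear.suminf[OF mm.bounded_linear_left summable_mexp]
    by (simp only: mm.scaleR_left)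
  also have "\<dots> = (\<Sum>k. (1 / fact k) *\<^sub>R (M ** matpow M k))"
    by (simp only: matpow_commute)
  also have "\<dots> = M ** mexp M"
    unfolding mexp_def bounded_linear.suminf[OF mm.bounded_linear_right summable_mexp]
    by (simp only: mm.scaleR_right)
  finally show ?thesis .
qed

lemma transpose_mexp: "transpose (mexp M) = mexp (transpose M)"
  unfolding mexp_def bounded_linear.suminf[OF bounded_linear_transpose summable_mexp]
  by (simp only: transpose_scalar transpose_matpow)

lemma mexp_zero: "mexp 0 = (mat 1 :: real^'n^'n)"
proof -
  have "matpow (0 :: real^'n^'n) (Suc k) = 0" for k
    by (simp add: matrix_matrix_mult_def vec_eq_iff)
  then have "(\<lambda>k. (1 / fact (Suc k)) *\<^sub>R matpow (0 :: real^'n^'n) (Suc k)) sums 0"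
    by (simp del: matpow.simps)
  then have "(\<lambda>k. (1 / fact k) *\<^sub>R matpow (0 :: real^'n^'n) k) sums mat 1"
    by (subst (asm) sums_Suc_iff) simp
  then show ?thesis
    unfolding mexp_def by (simp add: sums_iff)
qed

text \<open>Each entry of \<open>mexp (u *\<^sub>R M)\<close> is a power series in \<open>u\<close>
  that converges everywhere, so it may be differentiated term by term; the entries are then
  reassembled componentwise.\<close>

lemma has_vector_derivative_mexp:
  "((\<lambda>u. mexp (u *\<^sub>R M)) has_vector_derivative M ** mexp (u *\<^sub>R M)) (at u within S)"
proof -
  interpret mm: bounded_bilinear "(**) :: real^'a^'a \<Rightarrow> real^'a^'a \<Rightarrow> real^'a^'a"
    by (rule bounded_bilinear_matrix_mult)
  have lin: "bounded_linear (\<lambda>N :: real^'a^'a. N $ i $ j)" for i j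
    by (intro bounded_linear_compose[OF bounded_linear_vec_nth bounded_linear_vec_nth])
  have sum: "summable (\<lambda>k. (matpow M k $ i $ j / fact k) * u ^ k)" for u i j
    using bounded_linear.summable[OF lin summable_mexp[of "u *\<^sub>R M"]]
    by (simp add: matpow_scaleR mult_ac)
  have comp: "mexp (u *\<^sub>R M) $ i $ j = (\<Sum>k. (matpow M k $ i $ j / fact k) * u ^ k)" for u i j
    unfolding mexp_def bounded_linear.suminf[OF lin summable_mexp]
    by (simp add: matpow_scaleR mult_ac)
  have "(M ** mexp (u *\<^sub>R M)) $ i $ j =
      (\<Sum>k. diffs (\<lambda>k. matpow M k $ i $ j / fact k) k * u ^ k)" for i j
  proof -
    have "(M ** mexp (u *\<^sub>R M)) = (\<Sum>k. (1 / fact k) *\<^sub>R (M ** matpow (u *\<^sub>R M) k))"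
      unfolding mexp_def bounded_linear.suminf[OF mm.bounded_linear_right summable_mexp]
      by (simp only: mm.scaleR_right)
    moreover have "summable (\<lambda>k. (1 / fact k) *\<^sub>R (M ** matpow (u *\<^sub>R M) k))"
      using bounded_linear.summable[OF mm.bounded_linear_right summable_mexp, of M "u *\<^sub>R M"]
      by (simp add: mm.scaleR_right)
    ultimately have "(M ** mexp (u *\<^sub>R M)) $ i $ j =
        (\<Sum>k. ((1 / fact k) *\<^sub>R (M ** matpow (u *\<^sub>R M) k)) $ i $ j)"
      by (simp only: bounded_linear.suminf[OF lin])
    \<comment> \<open>\<open>diffs\<close> multiplies the coefficient of index \<open>Suc k\<close>
      by \<open>Suc k\<close>, which reduces \<open>fact (Suc k)\<close> to \<open>fact k\<close>,
      while \<open>matpow M (Suc k)\<close> supplies the extra factor \<open>M\<close>.\<close>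
    also have "\<dots> = (\<Sum>k. diffs (\<lambda>k. matpow M k $ i $ j / fact k) k * u ^ k)"
      by (intro suminf_cong)
         (simp add: diffs_def matpow_scaleR mm.scaleR_right divide_simps del: of_nat_Suc)
    finally show ?thesis .
  qed
  with termdiffs_strong_converges_everywhere[OF sum]
  have "((\<lambda>u. mexp (u *\<^sub>R M) $ i $ j) has_real_derivative (M ** mexp (u *\<^sub>R M)) $ i $ j)
      (at u)" for i j
    unfolding comp by simp
  then have "((\<lambda>u. mexp (u *\<^sub>R M)) has_vector_derivative M ** mexp (u *\<^sub>R M)) (at u)"
    unfolding has_vector_derivative_def has_real_derivative_iff_has_vector_derivative
    by (subst has_derivative_componentwise_within)
       (auto simp: Basis_vec_def inner_axis)
  then show ?thesis by (rule has_vector_derivative_at_within)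
qed

subsection \<open>Rayleigh quotients and the logarithmic norm\<close>

text \<open>Eigenvectors for distinct eigenvalues are orthogonal, hence independent, and independent
  sets are finite here. Finiteness is what makes the \<open>Max\<close> in \<open>lambda_max\<close>
  an upper bound.\<close>

lemma finite_eigenvalues_symmetric:
  fixes S :: "real^'n^'n"
  assumes sym: "transpose S = S"
  shows "finite (eigenvalues S)"
proof -
  define v where "v c = (SOME v. v \<noteq> 0 \<and> S *v v = c *s v)" for c
  have v: "v c \<noteq> 0" "S *v v c = c *s v c" if "c \<in> eigenvalues S" for c
    using someI_ex[of "\<lambda>v. v \<noteq> 0 \<and> S *v v = c *s v"] that
    by (auto simp: v_def eigenvalues_def)
  have orth: "v c \<bullet> v e = 0" if "c \<in> eigenvalues S" "e \<in> eigenvalues S" "c \<noteq> e" for c e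
  proof -
    have "v c \<bullet> (S *v v e) = (S *v v c) \<bullet> v e"
      using inner_transpose_mult[of "v c" S "v e"] sym by simp
    then have "e * (v c \<bullet> v e) = c * (v c \<bullet> v e)"
      using v that by (simp add: scalar_mult_eq_scaleR)
    then show ?thesis using that by simp
  qed
  have inj: "inj_on v (eigenvalues S)"
    using orth v(1) by (metis inj_onI inner_eq_zero_iff)
  have "independent (v ` eigenvalues S)"
    by (rule pairwise_orthogonal_independent)
       (use orth v(1) in \<open>force simp: pairwise_def orthogonal_def\<close>)+
  then show ?thesis
    using inj by (metis finite_imageD independent_imp_finite)
qed

text \<open>A unit vector maximising the quadratic form of \<open>S\<close> is an eigenvector: with \<open>l\<close> the
  maximum, \<open>l I - S\<close> is positive semidefinite and its quadratic form vanishes there.\<close>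

lemma rayleigh_le_lambda_max:
  fixes S :: "real^'n^'n"
  assumes sym: "transpose S = S"
  shows "x \<bullet> (S *v x) \<le> lambda_max S * (x \<bullet> x)"
proof -
  have "sphere 0 1 \<noteq> ({} :: (real^'n) set)" by simp
  moreover have "continuous_on (sphere 0 1) (\<lambda>x. x \<bullet> (S *v x))"
    by (intro continuous_intros linear_continuous_on matrix_vector_mul_bounded_linear)
  ultimately obtain v where v: "norm v = 1" and max: "\<And>y. norm y = 1 \<Longrightarrow> y \<bullet> (S *v y) \<le> v \<bullet> (S *v v)"
    using continuous_attains_sup[OF compact_sphere, of 0 1 "\<lambda>x. x \<bullet> (S *v x)"] by auto
  define l where "l = v \<bullet> (S *v v)"
  have le: "y \<bullet> (S *v y) \<le> l * (y \<bullet> y)" for y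
  proof (cases "y = 0")
    case False
    then have "(y /\<^sub>R norm y) \<bullet> (S *v (y /\<^sub>R norm y)) \<le> l"
      unfolding l_def by (intro max) simp
    then show ?thesis
      using False by (simp add: matrix_vector_mult_scaleR divide_simps dot_square_norm power2_eq_square)
  qed simp
  \<comment> \<open>\<open>w\<close> is zero exactly when \<open>v\<close> is an eigenvector for
    \<open>l\<close>. Moving from \<open>v\<close> along \<open>w\<close> turns the semidefinite
    form into a polynomial in \<open>e\<close> with linear coefficient
    \<open>2 * (w \<bullet> w)\<close>.\<close>
  define w where "w = l *\<^sub>R v - S *v v"
  define q where "q = l * (w \<bullet> w) - w \<bullet> (S *v w)"
  have cross: "v \<bullet> (S *v w) = w \<bullet> (S *v v)"
    using inner_transpose_mult[of v S w] sym by (simp add: inner_commute)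
  have quad: "0 \<le> 2 * e * (w \<bullet> w) + e^2 * q" for e
  proof -
    have "0 \<le> l * ((v + e *\<^sub>R w) \<bullet> (v + e *\<^sub>R w)) - (v + e *\<^sub>R w) \<bullet> (S *v (v + e *\<^sub>R w))"
      using le by simp
    also have "\<dots> = (l * (v \<bullet> v) - v \<bullet> (S *v v)) + 2 * e * (l * (w \<bullet> v) - w \<bullet> (S *v v)) + e^2 * q"
      unfolding q_def
      by (simp add: inner_add_left inner_add_right matrix_vector_right_distrib
        matrix_vector_mult_scaleR cross inner_commute[of v w] algebra_simps power2_eq_square)
    also have "l * (w \<bullet> v) - w \<bullet> (S *v v) = w \<bullet> (l *\<^sub>R v - S *v v)"
      by (simp add: inner_diff_right)
    also have "\<dots> = w \<bullet> w" by (simp add: w_def)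
    also have "l * (v \<bullet> v) - v \<bullet> (S *v v) = 0"
      using v by (simp add: l_def dot_square_norm)
    finally show ?thesis by simp
  qed
  have "w \<bullet> w = 0"
  proof (rule ccontr)
    assume "w \<bullet> w \<noteq> 0"
    then have ww: "0 < w \<bullet> w" by simp
    \<comment> \<open>Negative, and so small that \<open>e * q\<close> is at least
      \<open>- (w \<bullet> w)\<close>: the linear term then outweighs the quadratic one and the
      polynomial becomes negative.\<close>
    define e where "e = - (w \<bullet> w) / (\<bar>q\<bar> + 1)"
    have "q / (\<bar>q\<bar> + 1) \<le> 1" unfolding divide_le_eq_1 by linarith
    from mult_left_mono[OF this, of "w \<bullet> w"] have "- (w \<bullet> w) \<le> e * q"
      using ww by (simp add: e_def)
    then have "0 < 2 * (w \<bullet> w) + e * q" using ww by linarith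
    moreover have "e < 0" unfolding e_def using ww by (intro divide_neg_pos) auto
    ultimately have "e * (2 * (w \<bullet> w) + e * q) < 0" by (simp add: mult_neg_pos)
    then show False using quad[of e] by (simp add: algebra_simps power2_eq_square)
  qed
  then have "S *v v = l *s v" by (simp add: w_def scalar_mult_eq_scaleR)
  moreover have "v \<noteq> 0" using v by auto
  ultimately have "l \<in> eigenvalues S" by (auto simp: eigenvalues_def)
  then have "l \<le> lambda_max S"
    unfolding lambda_max_def by (intro Max_ge finite_eigenvalues_symmetric sym)
  then show ?thesis
    using le[of x] mult_right_mono[of l "lambda_max S" "x \<bullet> x"] by simp
qed

text \<open>\<open>A\<close> and \<open>transpose A\<close> have the same quadratic form, so that of
  \<open>A\<close> is half the form of the symmetric matrix \<open>A + transpose A\<close>.\<close>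

lemma inner_mult_le_mu2: "x \<bullet> (A *v x) \<le> mu2 A * (x \<bullet> x)"
proof -
  have "transpose (A + transpose A) = A + transpose A"
    by (simp add: transpose_add add.commute)
  from rayleigh_le_lambda_max[OF this, of x]
  have "x \<bullet> (A *v x) + x \<bullet> (transpose A *v x) \<le> lambda_max (A + transpose A) * (x \<bullet> x)"
    by (simp only: matrix_vector_mult_add_rdistrib inner_add_right)
  moreover have "x \<bullet> (transpose A *v x) = x \<bullet> (A *v x)"
    by (simp only: inner_transpose_mult inner_commute)
  ultimately show ?thesis by (simp add: mu2_def)
qed

text \<open>A Gronwall argument: the squared norm of \<open>z u\<close>, weighted by
  \<open>exp (- (2 * mu2 A * u))\<close>, is nonincreasing because
  \<open>z u \<bullet> (A *v z u)\<close> is at most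
  \<open>mu2 A * (z u \<bullet> z u)\<close>.\<close>

lemma norm_mexp_transpose_le:
  assumes "0 \<le> u"
  shows "norm (mexp (u *\<^sub>R transpose A) *v x) \<le> exp (mu2 A * u) * norm x"
proof -
  define z where "z u = mexp (u *\<^sub>R transpose A) *v x" for u
  define f where "f u = exp (- (2 * mu2 A * u)) * (z u \<bullet> z u)" for u
  have z: "(z has_vector_derivative transpose A *v z u) (at u)" for u
    unfolding z_def matrix_vector_mul_assoc
    using matrix_vector_mult_has_vector_derivative[OF has_vector_derivative_mexp[of "transpose A" u UNIV]
        has_vector_derivative_const[of x]] by simp
  have f: "(f has_real_derivative
      exp (- (2 * mu2 A * u)) * (2 * (z u \<bullet> (A *v z u) - mu2 A * (z u \<bullet> z u)))) (at u)" for u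
  proof -
    have "((\<lambda>u. z u \<bullet> z u) has_real_derivative 2 * (z u \<bullet> (A *v z u))) (at u)"
      unfolding has_real_derivative_iff_has_vector_derivative
      using bounded_bilinear.has_vector_derivative[OF bounded_bilinear_inner z z, of u]
      by (simp only: inner_transpose_mult inner_commute[of "transpose A *v z u"]) 
         (simp add: inner_commute)
    note [derivative_intros] = this
    show ?thesis
      unfolding f_def by (auto intro!: derivative_eq_intros simp: algebra_simps)
  qed
  have "f u \<le> f 0"
  proof (rule DERIV_nonpos_imp_nonincreasing[OF assms])
    fix v
    have "exp (- (2 * mu2 A * v)) * (2 * (z v \<bullet> (A *v z v) - mu2 A * (z v \<bullet> z v))) \<le> 0"
      using inner_mult_le_mu2[of "z v" A] by (simp add: mult_le_0_iff)
    with f show "\<exists>y. (f has_real_derivative y) (at v) \<and> y \<le> 0" by blast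
  qed
  then have "z u \<bullet> z u \<le> exp (2 * mu2 A * u) * (x \<bullet> x)"
    by (simp add: f_def z_def mexp_zero exp_minus divide_simps mult_ac)
  also have "exp (2 * mu2 A * u) * (x \<bullet> x) = (exp (mu2 A * u) * norm x)^2"
    by (simp add: power_mult_distrib dot_square_norm exp_double[symmetric] mult_ac)
  finally have "(norm (z u))^2 \<le> (exp (mu2 A * u) * norm x)^2"
    by (simp add: dot_square_norm)
  then show ?thesis
    unfolding z_def by (rule power2_le_imp_le) simp
qed

subsection \<open>The low-dimensional differential Lyapunov equation\<close>

text \<open>The solution of the homogeneous equation \<open>Y' = T ** Y + Y ** transpose T\<close>
  with initial value \<open>C\<close>.\<close>

definition mexp_congruence :: "real^'k^'k \<Rightarrow> real^'k^'k \<Rightarrow> real \<Rightarrow> real^'k^'k" where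
  "mexp_congruence T C u = mexp (u *\<^sub>R T) ** C ** mexp (u *\<^sub>R transpose T)"

text \<open>The variation of constants integral for the source term \<open>C\<close>; with
  \<open>C = Bm ** transpose Bm\<close> and \<open>T = Tm\<close> it is \<open>G\<close>.\<close>

definition lyapunov_integral :: "real^'k^'k \<Rightarrow> real^'k^'k \<Rightarrow> real \<Rightarrow> real \<Rightarrow> real^'k^'k" where
  "lyapunov_integral T C t0 t = integral {t0..t} (\<lambda>\<tau>. mexp_congruence T C (t - \<tau>))"

lemma has_vector_derivative_mexp_congruence:
  fixes T C :: "real^'k^'k"
  defines "F \<equiv> mexp_congruence T C"
  shows "(F has_vector_derivative T ** F u + F u ** transpose T) (at u within S)"
proof -
  interpret mm: bounded_bilinear "(**) :: real^'k^'k \<Rightarrow> real^'k^'k \<Rightarrow> real^'k^'k"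
    by (rule bounded_bilinear_matrix_mult)
  \<comment> \<open>\<open>mexp_commute\<close> gives this identity only after multiplication by
    \<open>u\<close>, hence the separate case \<open>u = 0\<close>.\<close>
  have comm: "transpose T ** mexp (u *\<^sub>R transpose T) = mexp (u *\<^sub>R transpose T) ** transpose T"
  proof (cases "u = 0")
    case True
    then show ?thesis by (simp add: mexp_zero)
  next
    case False
    have "u *\<^sub>R (transpose T ** mexp (u *\<^sub>R transpose T)) = u *\<^sub>R (mexp (u *\<^sub>R transpose T) ** transpose T)"
      using mexp_commute[of "u *\<^sub>R transpose T"] by (simp only: mm.scaleR_left mm.scaleR_right)
    with False show ?thesis by (rule scaleR_left_imp_eq)
  qed
  have "((\<lambda>u. mexp (u *\<^sub>R T) ** C) has_vector_derivative T ** mexp (u *\<^sub>R T) ** C) (at u within S)"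
    by (rule bounded_linear.has_vector_derivative[OF mm.bounded_linear_left has_vector_derivative_mexp])
  from matrix_mult_has_vector_derivative[OF this has_vector_derivative_mexp[of "transpose T"]]
  show ?thesis
    unfolding F_def mexp_congruence_def comm by (simp only: matrix_mul_assoc add.commute)
qed

lemma continuous_on_mexp_congruence:
  assumes "continuous_on S f"
  shows "continuous_on S (\<lambda>x. mexp_congruence T C (f x))"
proof -
  have "continuous_on UNIV (mexp_congruence T C)"
    by (meson continuous_on_eq_continuous_within has_vector_derivative_continuous
      has_vector_derivative_mexp_congruence)
  then show ?thesis using assms by (rule continuous_on_compose2) simp
qed

text \<open>Time reversal removes \<open>t\<close> from the integrand, so the derivative is
  \<open>F (t - t0)\<close>. Integrating the homogeneous equation for \<open>F\<close> over
  \<open>{t0..t}\<close> identifies this value with the right-hand side.\<close>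

lemma lyapunov_integral_has_vector_derivative:
  fixes T C :: "real^'k^'k" and t0 t Tf :: real
  defines "G \<equiv> lyapunov_integral T C t0"
  assumes t: "t \<in> {t0..Tf}"
  shows "(G has_vector_derivative T ** G t + G t ** transpose T + C) (at t within {t0..Tf})"
proof -
  define F where "F = mexp_congruence T C"
  have F: "(F has_vector_derivative T ** F u + F u ** transpose T) (at u within S)" for u S
    unfolding F_def by (rule has_vector_derivative_mexp_congruence)
  have cont: "continuous_on S (\<lambda>x. F (f x))" if "continuous_on S f" for S f
    unfolding F_def using that by (rule continuous_on_mexp_congruence)
  \<comment> \<open>The substitution \<open>u = t + t0 - \<tau>\<close>. Both integrals are
    transported from \<open>{0..t - t0}\<close>, one by a shift, the other by a reflection followed
    by a shift.\<close>
  have G: "G t = integral {t0..t} (\<lambda>u. F (u - t0))" for t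
  proof -
    have "G t = integral {t0..t} (\<lambda>\<tau>. F (t - \<tau>))"
      by (simp add: G_def F_def lyapunov_integral_def)
    also have "\<dots> = integral {t0..t} (\<lambda>u. F (u - t0))"
    proof (cases "t0 \<le> t")
      case True
      have int: "(F has_integral integral {0..t - t0} F) {0..t - t0}"
        by (intro integrable_integral integrable_continuous_interval cont[OF continuous_on_id])
      from has_integral_shift_real_ivl[OF this, of "- t0"]
      have 1: "((\<lambda>u. F (u - t0)) has_integral integral {0..t - t0} F) {t0..t}"
        by simp
      have "((\<lambda>u. F (- u)) has_integral integral {0..t - t0} F) {-(t - t0)..-0}"
        using int
        by (rule has_integral_reflect_lemma_real)
      from has_integral_shift_real_ivl[OF this, of "- t"]
      have 2: "((\<lambda>\<tau>. F (t - \<tau>)) has_integral integral {0..t - t0} F) {t0..t}"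
        by simp
      show ?thesis using 1 2 by (simp add: integral_unique)
    qed simp
    finally show ?thesis .
  qed
  have "G = (\<lambda>t. integral {t0..t} (\<lambda>u. F (u - t0)))"
    using G by (rule ext)
  then have deriv: "(G has_vector_derivative F (t - t0)) (at t within {t0..Tf})"
    using t by (simp only:) (auto intro!: integral_has_vector_derivative cont continuous_intros)
  have "((\<lambda>u. T ** F (u - t0) + F (u - t0) ** transpose T) has_integral F (t - t0) - F (t0 - t0)) {t0..t}"
  proof (rule fundamental_theorem_of_calculus)
    fix s
    show "((\<lambda>u. F (u - t0)) has_vector_derivative T ** F (s - t0) + F (s - t0) ** transpose T)
      (at s within {t0..t})"
    proof -
      have "((\<lambda>u. u - t0) has_vector_derivative 1) (at s within {t0..t})"
        by (auto intro!: derivative_eq_intros)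
      from vector_diff_chain_within[OF this F] show ?thesis by (simp add: o_def)
    qed
  qed (use t in auto)
  moreover have "((\<lambda>u. T ** F (u - t0) + F (u - t0) ** transpose T) has_integral T ** G t + G t ** transpose T) {t0..t}"
  proof -
    have "((\<lambda>u. F (u - t0)) has_integral G t) {t0..t}"
      unfolding G
      by (intro integrable_integral integrable_continuous_interval cont continuous_intros)
    from has_integral_linear[OF this bounded_bilinear.bounded_linear_right[OF bounded_bilinear_matrix_mult, of T]]
      has_integral_linear[OF this bounded_bilinear.bounded_linear_left[OF bounded_bilinear_matrix_mult, of "transpose T"]]
    show ?thesis
      by (intro has_integral_add) (simp_all add: o_def)
  qed
  ultimately have "F (t - t0) - F (t0 - t0) = T ** G t + G t ** transpose T"
    by (rule has_integral_unique)
  then have "F (t - t0) = T ** G t + G t ** transpose T + C"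
    by (simp add: F_def mexp_congruence_def mexp_zero algebra_simps)
  with deriv show ?thesis by simp
qed

text \<open>Transposition exchanges the two outer exponentials of the congruence and commutes with
  the integral. Symmetry of \<open>G\<close> makes the two halves of the residual transposes of each
  other.\<close>

lemma transpose_lyapunov_integral:
  fixes T C :: "real^'k^'k"
  assumes "transpose C = C"
  shows "transpose (lyapunov_integral T C t0 t) = lyapunov_integral T C t0 t"
proof -
  have "transpose (mexp_congruence T C u) = mexp_congruence T C u" for u
    by (simp add: mexp_congruence_def matrix_transpose_mul transpose_mexp transpose_scalar assms matrix_mul_assoc)
  moreover have "(\<lambda>\<tau>. mexp_congruence T C (t - \<tau>)) integrable_on {t0..t}"
    by (intro integrable_continuous_interval continuous_on_mexp_congruence continuous_intros)
  from integral_linear[OF this bounded_linear_transpose]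
  have "transpose (integral {t0..t} (\<lambda>\<tau>. mexp_congruence T C (t - \<tau>))) = integral {t0..t} (\<lambda>\<tau>. transpose (mexp_congruence T C (t - \<tau>)))"
    by (simp add: o_def)
  ultimately show ?thesis unfolding lyapunov_integral_def by simp
qed

subsection \<open>Perturbation of the differential Lyapunov equation\<close>

text \<open>The adjoint solutions \<open>z s = exp ((t - s) A\<^sup>T) x\<close> and \<open>w s = exp ((t - s) A\<^sup>T) y\<close> turn the matrix
  equation into \<open>d/ds (z \<bullet> E w) = z \<bullet> R w\<close>, which avoids the variation of constants formula.\<close>

lemma lyapunov_perturbation_bound:
  fixes A :: "real^'n^'n" and E R :: "real \<Rightarrow> real^'n^'n"
  assumes ode: "\<And>s. s \<in> {t0..t} \<Longrightarrow>
      (E has_vector_derivative A ** E s + E s ** transpose A + R s) (at s within {t0..t})"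
    and zero: "E t0 = 0"
    and R: "\<And>s x y. s \<in> {t0..t} \<Longrightarrow> x \<bullet> (R s *v y) \<le> \<rho> * (norm x * norm y)"
    and \<rho>: "0 \<le> \<rho>" and mu2: "mu2 A \<noteq> 0" and t: "t0 \<le> t"
  shows "spectral_norm (E t) \<le> \<rho> * ((exp (2 * (t - t0) * mu2 A) - 1) / (2 * mu2 A))"
proof (rule spectral_norm_leI)
  fix x y :: "real^'n"
  define z where "z x s = mexp ((t - s) *\<^sub>R transpose A) *v x" for x s
  have z: "(z x has_vector_derivative - (transpose A *v z x s)) (at s within S)" for x s S
  proof -
    have 1: "((\<lambda>s. t - s) has_vector_derivative -1) (at s within S)"
      by (auto intro!: derivative_eq_intros)
    have "((\<lambda>u. mexp (u *\<^sub>R transpose A) *v x) has_vector_derivative transpose A *v z x s) (at (t - s) within (\<lambda>s. t - s) ` S)"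
      unfolding z_def matrix_vector_mul_assoc
      by (rule bounded_linear.has_vector_derivative[OF
          bounded_bilinear.bounded_linear_left[OF bounded_bilinear_matrix_vector_mult] has_vector_derivative_mexp])
    from vector_diff_chain_within[OF 1 this] show ?thesis
      by (simp add: o_def z_def[abs_def])
  qed
  have norm_z: "norm (z x s) \<le> exp (mu2 A * (t - s)) * norm x" if "s \<le> t" for x s
    unfolding z_def using that by (intro norm_mexp_transpose_le) simp
  define c where "c = \<rho> * (norm x * norm y)"
  \<comment> \<open>The derivative of \<open>z y\<close> cancels \<open>E s ** transpose A\<close>,
    and the derivative of \<open>z x\<close> cancels \<open>A ** E s\<close>; only
    \<open>R s\<close> survives.\<close>
  have "((\<lambda>s. z x s \<bullet> (E s *v z y s)) has_vector_derivative z x s \<bullet> (R s *v z y s)) (at s within {t0..t})"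
    if "s \<in> {t0..t}" for s
  proof -
    have "((\<lambda>s. E s *v z y s) has_vector_derivative
      E s *v (- (transpose A *v z y s)) + (A ** E s + E s ** transpose A + R s) *v z y s) (at s within {t0..t})"
      by (rule matrix_vector_mult_has_vector_derivative[OF ode[OF that] z])
    also have "E s *v (- (transpose A *v z y s)) + (A ** E s + E s ** transpose A + R s) *v z y s
        = A *v (E s *v z y s) + R s *v z y s"
      by (simp only: matrix_vector_mult_add_rdistrib matrix_vector_mul_assoc[symmetric]
         bounded_bilinear.minus_right[OF bounded_bilinear_matrix_vector_mult]) simp
    finally have "((\<lambda>s. z x s \<bullet> (E s *v z y s)) has_vector_derivative
        z x s \<bullet> (A *v (E s *v z y s) + R s *v z y s) + (- (transpose A *v z x s)) \<bullet> (E s *v z y s)) (at s within {t0..t})"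
      by (rule bounded_bilinear.has_vector_derivative[OF bounded_bilinear_inner z])
    also have "z x s \<bullet> (A *v (E s *v z y s) + R s *v z y s) + (- (transpose A *v z x s)) \<bullet> (E s *v z y s)
        = z x s \<bullet> (R s *v z y s)"
      using inner_transpose_mult[of "E s *v z y s" A "z x s"]
      by (simp only: inner_add_right inner_minus_left inner_commute[of "A *v (E s *v z y s)"] inner_commute[of "E s *v z y s" "transpose A *v z x s"])
    finally show ?thesis .
  qed
  then have int1: "((\<lambda>s. z x s \<bullet> (R s *v z y s)) has_integral
      z x t \<bullet> (E t *v z y t) - z x t0 \<bullet> (E t0 *v z y t0)) {t0..t}"
    by (rule fundamental_theorem_of_calculus[OF t])
  \<comment> \<open>The dominating integrand: each of the two adjoint solutions contributes one
    factor \<open>exp (mu2 A * (t - s))\<close>.\<close>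
  have int2: "((\<lambda>s. c * exp (2 * mu2 A * (t - s))) has_integral
      (- c * exp (2 * mu2 A * (t - t)) / (2 * mu2 A)) - (- c * exp (2 * mu2 A * (t - t0)) / (2 * mu2 A))) {t0..t}"
    using mu2
    by (intro fundamental_theorem_of_calculus[OF t])
       (auto intro!: derivative_eq_intros simp flip: has_real_derivative_iff_has_vector_derivative)
  have "z x t \<bullet> (E t *v z y t) - z x t0 \<bullet> (E t0 *v z y t0)
    \<le> (- c * exp (2 * mu2 A * (t - t)) / (2 * mu2 A)) - (- c * exp (2 * mu2 A * (t - t0)) / (2 * mu2 A))"
  proof (rule has_integral_le[OF int1 int2])
    fix s assume s: "s \<in> {t0..t}"
    have "z x s \<bullet> (R s *v z y s) \<le> \<rho> * (norm (z x s) * norm (z y s))"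
      using R[OF s] .
    also have "\<dots> \<le> \<rho> * ((exp (mu2 A * (t - s)) * norm x) * (exp (mu2 A * (t - s)) * norm y))"
      using s \<rho> by (intro mult_left_mono mult_mono norm_z) auto
    also have "\<dots> = c * (exp (mu2 A * (t - s)) * exp (mu2 A * (t - s)))"
      by (simp add: c_def)
    also have "\<dots> = c * exp (2 * mu2 A * (t - s))"
      by (simp add: algebra_simps flip: exp_add)
    finally show "z x s \<bullet> (R s *v z y s) \<le> c * exp (2 * mu2 A * (t - s))" .
  qed
  \<comment> \<open>At \<open>s = t\<close> the adjoint solutions equal \<open>x\<close> and
    \<open>y\<close>; at \<open>s = t0\<close> the boundary term vanishes with
    \<open>E t0\<close>.\<close>
  then have "x \<bullet> (E t *v y) \<le> c * exp (2 * mu2 A * (t - t0)) / (2 * mu2 A) - c / (2 * mu2 A)"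
    by (simp add: z_def mexp_zero zero)
  also have "\<dots> = \<rho> * ((exp (2 * (t - t0) * mu2 A) - 1) / (2 * mu2 A)) * (norm x * norm y)"
    by (simp add: c_def algebra_simps diff_divide_distrib)
  finally show "x \<bullet> (E t *v y) \<le> \<dots>" .
qed

subsection \<open>The Arnoldi residual\<close>

text \<open>\<open>p\<close> is the orthogonal projection of \<open>x\<close> onto the sum of the
  two column spaces, and the claim is that the squared length of \<open>p - x\<close> is
  nonnegative.\<close>

lemma bessel_two_blocks:
  fixes U :: "real^'d^'n" and W :: "real^'k^'n"
  assumes "transpose U ** U = mat 1" "transpose W ** W = mat 1" "transpose U ** W = 0"
  shows "(norm (transpose U *v x))\<^sup>2 + (norm (transpose W *v x))\<^sup>2 \<le> (norm x)\<^sup>2"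
proof -
  define a b p where "a = transpose U *v x" and "b = transpose W *v x" and "p = U *v a + W *v b"
  have "transpose W ** U = 0"
    using arg_cong[OF assms(3), of transpose] by (simp add: matrix_transpose_mul) (simp add: transpose_def vec_eq_iff)
  then have "transpose U *v p = a" "transpose W *v p = b"
    unfolding p_def matrix_vector_right_distrib matrix_vector_mul_assoc assms by simp_all
  then have "p \<bullet> p = a \<bullet> a + b \<bullet> b"
    by (subst (1) p_def) (simp only: inner_add_left inner_transpose_mult[symmetric])
  moreover have "p \<bullet> x = a \<bullet> a + b \<bullet> b"
    by (simp only: p_def inner_add_left inner_transpose_mult[symmetric] a_def b_def)
  ultimately have "(p - x) \<bullet> (p - x) = x \<bullet> x - (a \<bullet> a + b \<bullet> b)"
    by (simp add: inner_diff_left inner_diff_right inner_commute)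
  then have "a \<bullet> a + b \<bullet> b \<le> x \<bullet> x"
    using inner_ge_zero[of "p - x"] by linarith
  then show ?thesis by (simp only: a_def b_def dot_square_norm)
qed

text \<open>Bounding the two summands separately would cost a factor 2. Cauchy-Schwarz in the plane
  for \<open>(a x, b x)\<close> and \<open>(b y, a y)\<close>, together with Bessel's inequality,
  keeps the constant 1.\<close>

lemma two_block_residual_bound:
  fixes U :: "real^'d^'n" and W :: "real^'k^'n" and N :: "real^'k^'d"
  assumes "transpose U ** U = mat 1" "transpose W ** W = mat 1" "transpose U ** W = 0"
  shows "x \<bullet> ((U ** N ** transpose W + W ** transpose N ** transpose U) *v y)
    \<le> spectral_norm N * (norm x * norm y)"
proof -
  define a b where "a x = norm (transpose U *v x)" and "b x = norm (transpose W *v x)" for x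
  have ab: "a x ^ 2 + b x ^ 2 \<le> norm x ^ 2" for x
    unfolding a_def b_def by (rule bessel_two_blocks[OF assms])
  have N: "u \<bullet> (N *v v) \<le> spectral_norm N * (norm u * norm v)" for u v
  proof -
    have "u \<bullet> (N *v v) \<le> norm u * norm (N *v v)" by (rule norm_cauchy_schwarz)
    also have "\<dots> \<le> norm u * (spectral_norm N * norm v)"
      by (intro mult_left_mono norm_mult_le_spectral_norm norm_ge_zero)
    finally show ?thesis by (simp add: mult_ac)
  qed
  have inner_mult: "u \<bullet> (M *v v) = (transpose M *v u) \<bullet> v" for M :: "real^'j^'n" and u v
    using inner_transpose_mult[of u "transpose M" v] by (simp only: transpose_transpose)
  have "x \<bullet> ((U ** N ** transpose W + W ** transpose N ** transpose U) *v y)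
      = (transpose U *v x) \<bullet> (N *v (transpose W *v y)) + (transpose U *v y) \<bullet> (N *v (transpose W *v x))"
    by (simp only: matrix_vector_mult_add_rdistrib inner_add_right inner_transpose_mult
      inner_mult matrix_vector_mul_assoc[symmetric] inner_commute[of "U *v _" y])
  also have "\<dots> \<le> spectral_norm N * (a x * b y) + spectral_norm N * (a y * b x)"
    unfolding a_def b_def by (intro add_mono N)
  also have "\<dots> = spectral_norm N * (a x * b y + b x * a y)"
    by (simp add: algebra_simps)
  also have "a x * b y + b x * a y \<le> norm x * norm y"
  proof (rule power2_le_imp_le)
    \<comment> \<open>Lagrange's identity: the two sides differ by the square of
      \<open>a x * a y - b x * b y\<close>.\<close>
    have "(a x * b y + b x * a y)\<^sup>2 \<le> (a x ^ 2 + b x ^ 2) * (a y ^ 2 + b y ^ 2)"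
      using zero_le_power2[of "a x * a y - b x * b y"] by (simp add: power2_eq_square algebra_simps)
    also have "\<dots> \<le> norm x ^ 2 * norm y ^ 2"
      by (intro mult_mono ab) auto
    finally show "(a x * b y + b x * a y)\<^sup>2 \<le> (norm x * norm y)\<^sup>2"
      by (simp add: power_mult_distrib)
  qed simp
  finally show ?thesis by (simp add: mult_left_mono spectral_norm_nonneg)
qed

section \<open>Orthonormality of the Arnoldi basis and the position of \<open>B\<close> in its
  range\<close>

lemma block_row_column: "column p (block_row V) = column (snd p) (V (block_no (fst p)))"
  by (simp add: block_row_def column_def)

lemma block_no_range: "block_no (i :: 'm::{finite,linorder}) \<in> {1..CARD('m)}"
  using bij_betw_block_no bij_betwE by blast

lemma inj_block_no: "inj block_no"
  using bij_betw_block_no bij_betw_imp_inj_on by blast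

text \<open>\<open>block_no\<close> maps injectively into the block numbers up to
  \<open>CARD('m)\<close>, so distinct columns of \<open>W\<close> stay distinct among the blocks
  and none of them meets block \<open>CARD('m) + 1\<close>.\<close>

lemma orthonormal_block_row:
  fixes V :: "nat \<Rightarrow> real^'d^'n"
  assumes "orthonormal_blocks V (CARD('m::{finite,linorder}) + 1)"
  defines "W \<equiv> block_row V :: real^('m \<times> 'd)^'n" and "U \<equiv> V (CARD('m) + 1)"
  shows "transpose U ** U = mat 1" "transpose W ** W = mat 1" "transpose U ** W = 0"
proof -
  have orth: "column c (V i) \<bullet> column e (V j) = (if i = j \<and> c = e then 1 else 0)"
    if "i \<in> {1..CARD('m) + 1}" "j \<in> {1..CARD('m) + 1}" for i j c e
    using assms(1) that unfolding orthonormal_blocks_def by blast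
  have no: "block_no (i :: 'm) \<in> {1..CARD('m) + 1}" "block_no i \<noteq> CARD('m) + 1" for i
    using block_no_range[of i] by auto
  show "transpose U ** U = mat 1"
    by (simp add: matrix_mult_transpose_dot_column U_def orth mat_def vec_eq_iff)
  show "transpose W ** W = mat 1"
    by (auto simp: matrix_mult_transpose_dot_column W_def block_row_column orth[OF no(1) no(1)]
        mat_def vec_eq_iff inj_eq[OF inj_block_no])
  have "(transpose U ** W) $ c $ p = column c U \<bullet> column p W" for c p
    by (simp add: matrix_matrix_mult_def transpose_def column_def inner_vec_def)
  moreover have "column c U \<bullet> column p W = 0" for c p
    using no(2)[of "fst p"] by (simp add: U_def W_def block_row_column orth[OF _ no(1)])
  ultimately show "transpose U ** W = 0"
    by (simp add: vec_eq_iff)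
qed

text \<open>\<open>W ** transpose W\<close> fixes every column of \<open>W\<close>, and its fixed
  points form a subspace, which therefore contains all columns of \<open>B\<close>.\<close>

lemma mult_transpose_mult_range:
  fixes W :: "real^'k^'n" and B :: "real^'s^'n"
  assumes W: "transpose W ** W = mat 1" and B: "columns B \<subseteq> span (columns W)"
  shows "W ** transpose W ** B = B"
proof -
  have "(W ** transpose W) *v column p W = column p W" for p
  proof -
    have "(W ** transpose W) *v (W *v axis p 1) = W *v ((transpose W ** W) *v axis p 1)"
      by (simp only: matrix_vector_mul_assoc matrix_mul_assoc)
    also have "\<dots> = W *v axis p 1"
      by (simp only: W matrix_vector_mul_lid)
    finally show ?thesis by (simp only: matrix_vector_mult_basis)
  qed
  then have "columns W \<subseteq> {v. (W ** transpose W) *v v = v}"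
    by (auto simp: columns_def)
  moreover have "subspace {v. (W ** transpose W) *v v = v}"
    by (simp add: subspace_def matrix_vector_right_distrib matrix_vector_mult_scaleR)
  ultimately have fixed: "(W ** transpose W) *v v = v" if "v \<in> span (columns W)" for v
    using span_minimal that by blast
  have "column j (W ** transpose W ** B) = column j B" for j
  proof -
    have "column j (W ** transpose W ** B) = (W ** transpose W) *v column j B"
      by (simp add: column_def matrix_matrix_mult_def matrix_vector_mult_def vec_eq_iff)
    also have "\<dots> = column j B"
      using B by (intro fixed) (auto simp: columns_def)
    finally show ?thesis .
  qed
  then show ?thesis by (simp add: column_def vec_eq_iff)
qed

text \<open>The power of index \<open>k = 0\<close> contributes the columns of \<open>B\<close>
  themselves; it is present as soon as \<open>m\<close> is positive.\<close>

lemma columns_subset_block_krylov: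
  assumes "0 < m"
  shows "columns B \<subseteq> block_krylov A B m"
  unfolding block_krylov_def using assms by (force intro: span_base)

lemma columns_subset_ext_block_krylov:
  assumes "0 < m"
  shows "columns B \<subseteq> ext_block_krylov A B m"
  unfolding ext_block_krylov_def using assms by (force intro: span_base)

text \<open>Turns the remainder of the Arnoldi relation, multiplied by \<open>G s\<close>, into an
  expression in the last \<open>d\<close> rows of \<open>G s\<close>.\<close>

lemma transpose_last_block_unit_mult: "transpose last_block_unit ** M = last_block_rows (M :: real^'k^('m::{finite,linorder} \<times> 'd::finite))"
  by (simp add: last_block_unit_def last_block_rows_def transpose_def matrix_matrix_mult_def mat_def
    vec_eq_iff if_distrib[of "\<lambda>x. x * _"] cong: if_cong)



section \<open>The error equation of the projected solution and its bound\<close>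

theorem theorem2p5:
  fixes A :: "real^'n^'n"
    and B :: "real^'s^'n"
    and V :: "nat \<Rightarrow> real^'d^'n"
    and Vm :: "real^('m::{finite,linorder} \<times> 'd)^'n"
    and Tm :: "real^('m \<times> 'd)^('m \<times> 'd)"
    and Tsub :: "real^'d^'d"
    and Bm :: "real^'s^('m \<times> 'd)"
    and G :: "real \<Rightarrow> real^('m \<times> 'd)^('m \<times> 'd)"
    and X Xm E :: "real \<Rightarrow> real^'n^'n"
    and X0 :: "real^'n^'n"
    and t0 Tf :: real
    and m :: nat
  assumes m: "m = CARD('m)"
    and nonsingular: "invertible A"
    and full_rank: "rank B = CARD('s)"
    and stable: "stable A"
    and mu2: "mu2 A \<noteq> 0"
    \<comment> \<open>output of the (extended) block Arnoldi algorithm\<close>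
    and orthonormal: "orthonormal_blocks V (m + 1)"
    and Vm: "Vm = block_row V"
    and krylov:
      "(CARD('d) = CARD('s) \<and> span (columns Vm) = block_krylov A B m) \<or>
       (CARD('d) = 2 * CARD('s) \<and> span (columns Vm) = ext_block_krylov A B m)"
    and Tm: "Tm = transpose Vm ** A ** Vm"
    and hessenberg: "block_upper_hessenberg Tm"
    and Tsub: "Tsub = transpose (V (m + 1)) ** A ** V m"
    and arnoldi: "A ** Vm = Vm ** Tm + V (m + 1) ** Tsub ** transpose last_block_unit"
    \<comment> \<open>approximate solution\<close>
    and Bm: "Bm = transpose Vm ** B"
    and G: "\<And>t. G t = integral {t0..t} (\<lambda>\<tau>.
              mexp ((t - \<tau>) *\<^sub>R Tm) ** Bm ** transpose Bm ** mexp ((t - \<tau>) *\<^sub>R transpose Tm))"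
    and Xm: "\<And>t. Xm t = Vm ** G t ** transpose Vm"
    \<comment> \<open>exact solution\<close>
    and ode: "\<And>t. t \<in> {t0..Tf} \<Longrightarrow>
              (X has_vector_derivative (A ** X t + X t ** transpose A + B ** transpose B))
                (at t within {t0..Tf})"
    and initial: "X t0 = X0"
    and initial_eq: "X t0 = Xm t0"
    and E: "\<And>t. E t = X t - Xm t"
  shows "\<forall>t\<in>{t0..Tf}.
           spectral_norm (E t) \<le>
             spectral_norm Tsub * (SUP \<tau>\<in>{t0..t}. spectral_norm (last_block_rows (G \<tau>))) *
             ((exp (2 * (t - t0) * mu2 A) - 1) / (2 * mu2 A))"
proof
  fix t assume t: "t \<in> {t0..Tf}"
  define U where "U = V (m + 1)"
  define C where "C = Bm ** transpose Bm"
  define N where "N s = Tsub ** last_block_rows (G s)" for s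
  define R where "R s = U ** N s ** transpose Vm + Vm ** transpose (N s) ** transpose U" for s
  define b where "b = (SUP \<tau>\<in>{t0..t}. spectral_norm (last_block_rows (G \<tau>)))"
  note ortho = orthonormal_block_row[OF orthonormal[unfolded m], folded Vm m, folded U_def]
  have "columns B \<subseteq> span (columns Vm)"
    using krylov columns_subset_block_krylov[of m B A] columns_subset_ext_block_krylov[of m B A]
    by (auto simp: m)
  then have "Vm ** transpose Vm ** B = B"
    by (rule mult_transpose_mult_range[OF ortho(2)])
  then have B: "Vm ** Bm = B"
    by (simp only: Bm matrix_mul_assoc)
  have G_eq: "G = lyapunov_integral Tm C t0"
    by (rule ext) (simp only: G lyapunov_integral_def mexp_congruence_def C_def matrix_mul_assoc)
  have dG: "(G has_vector_derivative Tm ** G s + G s ** transpose Tm + C) (at s within {t0..Tf})"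
    if "s \<in> {t0..Tf}" for s
    unfolding G_eq using that by (rule lyapunov_integral_has_vector_derivative)
  have "transpose C = C" by (simp add: C_def matrix_transpose_mul)
  then have sym: "transpose (G s) = G s" for s
    unfolding G_eq by (rule transpose_lyapunov_integral)
  have dXm: "(Xm has_vector_derivative Vm ** (Tm ** G s + G s ** transpose Tm + C) ** transpose Vm)
      (at s within {t0..Tf})" if "s \<in> {t0..Tf}" for s
    unfolding Xm[abs_def]
    by (intro bounded_linear.has_vector_derivative[OF
          bounded_bilinear.bounded_linear_left[OF bounded_bilinear_matrix_mult]]
        bounded_linear.has_vector_derivative[OF
          bounded_bilinear.bounded_linear_right[OF bounded_bilinear_matrix_mult]] dG that)
  \<comment> \<open>The Arnoldi relation splits \<open>A ** Xm s\<close> into a projected part and a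
    term in \<open>U\<close>; by symmetry of \<open>G s\<close>, transposing gives
    \<open>Xm s ** transpose A\<close>. The source term matches because
    \<open>Vm ** Bm = B\<close>.\<close>
  have residual: "Vm ** (Tm ** G s + G s ** transpose Tm + C) ** transpose Vm + R s
      = A ** Xm s + Xm s ** transpose A + B ** transpose B" for s
  proof -
    have "A ** Xm s = Vm ** Tm ** G s ** transpose Vm + U ** N s ** transpose Vm"
      unfolding Xm matrix_mul_assoc arnoldi U_def[symmetric] N_def transpose_last_block_unit_mult[symmetric]
      by (simp only: bounded_bilinear.add_left[OF bounded_bilinear_matrix_mult] matrix_mul_assoc)
    moreover have "Xm s ** transpose A = transpose (A ** Xm s)"
      by (simp only: Xm matrix_transpose_mul transpose_transpose sym matrix_mul_assoc)
    moreover have "B ** transpose B = Vm ** C ** transpose Vm"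
      unfolding B[symmetric] C_def by (simp only: matrix_transpose_mul matrix_mul_assoc)
    ultimately show ?thesis
      unfolding R_def
      by (simp add: transpose_add matrix_transpose_mul sym matrix_mul_assoc algebra_simps matrix_add_ldistrib
        bounded_bilinear.add_left[OF bounded_bilinear_matrix_mult])
  qed
  have bdd: "bdd_above ((\<lambda>\<tau>. spectral_norm (last_block_rows (G \<tau>))) ` {t0..t})"
  proof (rule bdd_above_spectral_norm)
    have "continuous_on {t0..Tf} G"
      using dG by (meson continuous_on_eq_continuous_within has_vector_derivative_continuous)
    then have "continuous_on {t0..t} G"
      by (rule continuous_on_subset) (use t in auto)
    then show "continuous_on {t0..t} (\<lambda>\<tau>. last_block_rows (G \<tau>))"
      unfolding last_block_rows_def by (intro continuous_intros)
  qed simp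
  \<comment> \<open>The supremum dominates its member at \<open>\<tau> = t\<close>, which is a
    norm.\<close>
  have b_nonneg: "0 \<le> b"
    unfolding b_def using t
    by (intro order_trans[OF spectral_norm_nonneg cSUP_upper[OF _ bdd, of t]]) auto
  have "spectral_norm (E t) \<le> (spectral_norm Tsub * b) * ((exp (2 * (t - t0) * mu2 A) - 1) / (2 * mu2 A))"
  proof (rule lyapunov_perturbation_bound)
    fix s assume s: "s \<in> {t0..t}"
    then have s': "s \<in> {t0..Tf}" using t by auto
    have "(E has_vector_derivative (A ** X s + X s ** transpose A + B ** transpose B)
        - Vm ** (Tm ** G s + G s ** transpose Tm + C) ** transpose Vm) (at s within {t0..Tf})"
      unfolding E[abs_def] by (intro has_vector_derivative_diff ode dXm s')
    also have "(A ** X s + X s ** transpose A + B ** transpose B)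
        - Vm ** (Tm ** G s + G s ** transpose Tm + C) ** transpose Vm
        = A ** E s + E s ** transpose A + R s"
      using residual[of s]
      by (simp add: E bounded_bilinear.diff_left[OF bounded_bilinear_matrix_mult]
        bounded_bilinear.diff_right[OF bounded_bilinear_matrix_mult] algebra_simps)
    \<comment> \<open>The error equation is restricted from \<open>{t0..Tf}\<close> to
      \<open>{t0..t}\<close>, the interval over which the supremum \<open>b\<close> is
      taken.\<close>
    finally show "(E has_vector_derivative A ** E s + E s ** transpose A + R s) (at s within {t0..t})"
      by (rule has_vector_derivative_within_subset) (use t in auto)
    fix x y
    have "x \<bullet> (R s *v y) \<le> spectral_norm (N s) * (norm x * norm y)"
      unfolding R_def by (rule two_block_residual_bound[OF ortho])
    also have "\<dots> \<le> (spectral_norm Tsub * b) * (norm x * norm y)"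
    proof (rule mult_right_mono)
      have "spectral_norm (N s) \<le> spectral_norm Tsub * spectral_norm (last_block_rows (G s))"
        unfolding N_def by (rule spectral_norm_mult)
      also have "\<dots> \<le> spectral_norm Tsub * b"
        unfolding b_def
        by (intro mult_left_mono cSUP_upper bdd s spectral_norm_nonneg)
      finally show "spectral_norm (N s) \<le> spectral_norm Tsub * b" .
    qed simp
    finally show "x \<bullet> (R s *v y) \<le> (spectral_norm Tsub * b) * (norm x * norm y)" .
  next
    show "E t0 = 0" by (simp add: E initial_eq)
    show "0 \<le> spectral_norm Tsub * b"
      by (intro mult_nonneg_nonneg spectral_norm_nonneg b_nonneg)
  qed (use t mu2 in auto)
  then show "spectral_norm (E t) \<le> spectral_norm Tsub * (SUP \<tau>\<in>{t0..t}. spectral_norm (last_block_rows (G \<tau>))) *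
      ((exp (2 * (t - t0) * mu2 A) - 1) / (2 * mu2 A))"
    by (simp only: b_def)
qed

end
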